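(* Let $p>n$, let $\mathbf Y_n=\mathbf\Sigma_n^{1/2}\mathbf X_n$ be the $p\times n$ observation matrix with columns $\mathbf y_1,\dots,\mathbf y_n$, and let $\tilde{\mathbf S}_n^+$ and $\mathbf S_n^+$ be the Moore-Penrose inverses of the centered sample covariance matrix $\tilde{\mathbf S}_n=\frac1n\mathbf Y_n\mathbf Y_n'-\bar{\mathbf y}\bar{\mathbf y}'$ and the non-centered sample covariance matrix $\mathbf S_n=\frac1n\mathbf Y_n\mathbf Y_n'$, respectively, where $\bar{\mathbf y}=\frac1n\sum_{i=1}^n\mathbf y_i$. Then $$\big\|F^{\tilde{\mathbf S}_n^+}-F^{\mathbf S_n^+}\big\|_\infty\le\frac2p ,$$ where $\|g\|_\infty$ is the supremum norm of a function $g:\mathbb R\to\mathbb R$.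
   Context: $\mathbf X_n$ is a $p\times n$ matrix of i.i.d. real random variables with zero mean and unit variance and $\mathbf\Sigma_n$ is a $p\times p$ covariance matrix. For a symmetric $p\times p$ matrix $\mathbf A$ with eigenvalues $\lambda_1(\mathbf A)\ge\dots\ge\lambda_p(\mathbf A)$, $F^{\mathbf A}(t)=\frac1p\sum_{i=1}^p\mathbb 1\{\lambda_i(\mathbf A)\le t\}$ is its empirical spectral distribution function. *)

theory Defs
  imports "HOL-Probability.Probability" "HOL-Computational_Algebra.Polynomial"
begin

text \<open>A \<open>p\<close> by \<open>n\<close> matrix has type \<open>real ^ 'n ^ 'p\<close> with \<open>p = CARD('p)\<close> and \<open>n = CARD('n)\<close>.\<close>

definition charpoly :: "real ^ 'p ^ 'p \<Rightarrow> real poly" where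
  "charpoly A = det (mat [:0, 1:] - (\<chi> i j. [:A $ i $ j:]))"

lemma poly_charpoly: "poly (charpoly A) x = det (mat x - A)"
proof -
  have "poly ((mat [:0, 1:] - (\<chi> i j. [:A $ i $ j:])) $ i $ j) x = (mat x - A) $ i $ j" for i j
    by (simp add: mat_def)
  then show ?thesis
    by (simp add: charpoly_def det_def poly_sum poly_prod)
qed

text \<open>The real eigenvalues, repeated according to algebraic multiplicity and listed in
  decreasing order. For a symmetric matrix all roots of the characteristic polynomial are real, so
  the list has length \<open>CARD('p)\<close> and \<open>eigvals A ! i\<close> is the \<open>(i + 1)\<close>-st largest eigenvalue.\<close>

definition eigvals :: "real ^ 'p ^ 'p \<Rightarrow> real list" where
  "eigvals A = rev (sorted_list_of_multiset (proots (charpoly A)))"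

lemma set_eigvals:
  fixes A :: "real ^ 'p ^ 'p"
  shows "x \<in> set (eigvals A) \<longleftrightarrow> (\<exists>v. v \<noteq> 0 \<and> A *v v = x *s v)"
proof -
  have mat_mult: "mat c *v v = c *s v" for c and v :: "real ^ 'p"
    by (simp add: matrix_vector_mult_def mat_def vec_eq_iff if_distrib if_distribR sum.delta cong: if_cong)
  have nz: "charpoly A \<noteq> 0"
  proof
    assume "charpoly A = 0"
    then have all: "det (mat x - A) = 0" for x
      using poly_charpoly[of A x] by simp
    obtain B where B: "\<And>v. norm (A *v v) \<le> norm v * B"
      using bounded_linear.bounded[OF matrix_vector_mul_bounded_linear[of A]] by blast
    obtain v where v: "v \<noteq> 0" "(mat (\<bar>B\<bar> + 1) - A) *v v = 0"
      using all[of "\<bar>B\<bar> + 1"] invertible_det_nz matrix_left_invertible_ker invertible_left_inverse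
      by metis
    then have "A *v v = (\<bar>B\<bar> + 1) *s v"
      by (auto simp: matrix_vector_mult_diff_rdistrib mat_mult)
    then have "norm (A *v v) = (\<bar>B\<bar> + 1) * norm v"
      by (simp add: scalar_mult_eq_scaleR)
    with B[of v] v(1) have "norm v * (\<bar>B\<bar> + 1) \<le> norm v * B" by (simp add: mult.commute)
    with v(1) show False by simp
  qed
  have "x \<in> set (eigvals A) \<longleftrightarrow> det (mat x - A) = 0"
    using nz by (simp add: eigvals_def poly_charpoly)
  also have "\<dots> \<longleftrightarrow> (\<exists>v. v \<noteq> 0 \<and> (mat x - A) *v v = 0)"
    using invertible_det_nz matrix_left_invertible_ker invertible_left_inverse by metis
  also have "\<dots> \<longleftrightarrow> (\<exists>v. v \<noteq> 0 \<and> A *v v = x *s v)"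
    by (auto simp: matrix_vector_mult_diff_rdistrib mat_mult)
  finally show ?thesis .
qed

definition esd :: "real ^ 'p ^ 'p \<Rightarrow> real \<Rightarrow> real" where
  "esd A t = 1 / real CARD('p) * (\<Sum>i<CARD('p). indicator {..t} (eigvals A ! i))"

definition psd :: "real ^ 'p ^ 'p \<Rightarrow> bool" where
  "psd A \<longleftrightarrow> transpose A = A \<and> (\<forall>v. 0 \<le> v \<bullet> (A *v v))"

definition psd_sqrt :: "real ^ 'p ^ 'p \<Rightarrow> real ^ 'p ^ 'p" where
  "psd_sqrt A = (THE R. psd R \<and> R ** R = A)"

definition is_mp_inverse :: "real ^ 'n ^ 'm \<Rightarrow> real ^ 'm ^ 'n \<Rightarrow> bool" where
  "is_mp_inverse A B \<longleftrightarrow> A ** B ** A = A \<and> B ** A ** B = B \<and>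
     transpose (A ** B) = A ** B \<and> transpose (B ** A) = B ** A"

lemma is_mp_inverse_unique:
  assumes "is_mp_inverse A B" "is_mp_inverse A C"
  shows "B = C"
proof -
  have B: "A ** B ** A = A" "B ** A ** B = B" "transpose (A ** B) = A ** B" "transpose (B ** A) = B ** A"
    and C: "A ** C ** A = A" "C ** A ** C = C" "transpose (A ** C) = A ** C" "transpose (C ** A) = C ** A"
    using assms by (auto simp: is_mp_inverse_def)
  have "A ** B = transpose ((A ** C) ** (A ** B))"
    by (metis B(3) C(1) matrix_mul_assoc)
  also have "\<dots> = A ** B ** (A ** C)" by (metis B(3) C(3) matrix_transpose_mul)
  also have "\<dots> = A ** C" by (metis B(1) matrix_mul_assoc)
  finally have 1: "A ** B = A ** C" .
  have "B ** A = transpose ((B ** A) ** (C ** A))"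
    by (metis B(4) C(1) matrix_mul_assoc)
  also have "\<dots> = (C ** A) ** (B ** A)" by (metis B(4) C(4) matrix_transpose_mul)
  also have "\<dots> = C ** A" by (metis B(1) matrix_mul_assoc)
  finally have 2: "B ** A = C ** A" .
  show ?thesis by (metis 1 2 B(2) C(2) matrix_mul_assoc)
qed

definition mp_inverse :: "real ^ 'n ^ 'm \<Rightarrow> real ^ 'm ^ 'n" where
  "mp_inverse A = (THE B. is_mp_inverse A B)"

definition sample_mean :: "real ^ 'n ^ 'p \<Rightarrow> real ^ 'p" where
  "sample_mean Y = (1 / real CARD('n)) *\<^sub>R (\<Sum>i\<in>UNIV. column i Y)"

definition sample_cov :: "real ^ 'n ^ 'p \<Rightarrow> real ^ 'p ^ 'p" where
  "sample_cov Y = (1 / real CARD('n)) *\<^sub>R (Y ** transpose Y)"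

definition centered_sample_cov :: "real ^ 'n ^ 'p \<Rightarrow> real ^ 'p ^ 'p" where
  "centered_sample_cov Y =
     sample_cov Y - (\<chi> i j. sample_mean Y $ i * sample_mean Y $ j)"

text \<open>Extended-real valued, so that the supremum of an unbounded function is \<open>\<infinity>\<close>.\<close>

definition sup_norm :: "(real \<Rightarrow> real) \<Rightarrow> ereal" where
  "sup_norm g = (SUP t. ereal \<bar>g t\<bar>)"

definition iid_standardized_entries :: "'a measure \<Rightarrow> ('a \<Rightarrow> real ^ 'n ^ 'p) \<Rightarrow> bool" where
  "iid_standardized_entries M X \<longleftrightarrow>
     prob_space.indep_vars M (\<lambda>_. borel) (\<lambda>(i, j) \<omega>. X \<omega> $ i $ j) UNIV \<and>
     (\<forall>i j k l. distr M borel (\<lambda>\<omega>. X \<omega> $ i $ j) = distr M borel (\<lambda>\<omega>. X \<omega> $ k $ l)) \<and>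
     (\<forall>i j. integrable M (\<lambda>\<omega>. X \<omega> $ i $ j) \<and>
            integrable M (\<lambda>\<omega>. (X \<omega> $ i $ j)\<^sup>2) \<and>
            prob_space.expectation M (\<lambda>\<omega>. X \<omega> $ i $ j) = 0 \<and>
            prob_space.variance M (\<lambda>\<omega>. X \<omega> $ i $ j) = 1)"

end

theory Submission
  imports Defs
begin

text \<open>Diagonalise the two covariance matrices of a fixed realisation of \<open>Y\<close>; the Moore-Penrose
  inverse inverts the nonzero eigenvalues. For \<open>t \<ge> 0\<close> an eigenvalue
  \<open>d \<ge> 0\<close> satisfies \<open>inverse d \<le> t\<close> iff \<open>d = 0\<close> or \<open>t * d \<ge> 1\<close>. The two matrices differ
  by a matrix of rank one, so each of these two counts changes by at most one.\<close>

section \<open>Spectral theorem for self-adjoint maps on a Euclidean space\<close>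

lemma orthogonal_to_few_exists:
  fixes B :: "'a::euclidean_space set"
  assumes "finite B" "card B < DIM('a)"
  obtains v where "v \<noteq> 0" "\<And>b. b \<in> B \<Longrightarrow> b \<bullet> v = 0"
proof -
  have "dim (span B) < DIM('a)"
    using assms dim_le_card'[of B] by simp
  then obtain v where "v \<noteq> 0" "\<And>y. y \<in> span (span B) \<Longrightarrow> orthogonal v y"
    using orthogonal_to_subspace_exists[of "span B"] by metis
  then show thesis
    using that by (metis inner_commute orthogonal_def span_base span_span)
qed

text \<open>The quadratic form \<open>v \<bullet> f v\<close> attains its maximum on the compact
  unit sphere of \<open>S\<close>, and a maximiser is an eigenvector. Invariance of \<open>S\<close>
  keeps the residual \<open>f u - c *\<^sub>R u\<close> inside \<open>S\<close>, where maximality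
  can be tested against it.\<close>

lemma self_adjoint_eigenvector_exists:
  fixes f :: "'a::euclidean_space \<Rightarrow> 'a"
  assumes lin: "linear f" and adj: "\<And>x y. f x \<bullet> y = x \<bullet> f y"
    and S: "subspace S" "S \<noteq> {0}" and inv: "f ` S \<subseteq> S"
  obtains u c where "u \<in> S" "norm u = 1" "f u = c *\<^sub>R u"
proof -
  obtain w where w: "w \<in> S" "w \<noteq> 0"
    using S subspace_0 by blast
  have "(1 / norm w) *\<^sub>R w \<in> sphere 0 1 \<inter> S"
    using w S by (simp add: subspace_scale)
  then have ne: "sphere 0 1 \<inter> S \<noteq> {}" by blast
  have "compact (sphere 0 1 \<inter> S)"
    using S(1) by (simp add: closed_subspace compact_Int_closed)
  moreover have "continuous_on (sphere 0 1 \<inter> S) (\<lambda>v. v \<bullet> f v)"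
    using lin by (intro continuous_intros linear_continuous_on linear_conv_bounded_linear[THEN iffD1])
  ultimately obtain u where u: "u \<in> S" "norm u = 1"
    and max: "\<And>v. v \<in> S \<Longrightarrow> norm v = 1 \<Longrightarrow> v \<bullet> f v \<le> u \<bullet> f u"
    using continuous_attains_sup[OF _ ne, of "\<lambda>v. v \<bullet> f v"] by auto
  define c where "c = u \<bullet> f u"
  \<comment> \<open>Homogeneity carries the maximum from the unit sphere to all of \<open>S\<close>,
    so perturbations of \<open>u\<close> need not be normalised.\<close>
  have le: "v \<bullet> f v \<le> c * (v \<bullet> v)" if "v \<in> S" for v
  proof (cases "v = 0")
    case False
    have "((1 / norm v) *\<^sub>R v) \<bullet> f ((1 / norm v) *\<^sub>R v) \<le> c"
      unfolding c_def using False that S by (intro max) (auto simp: subspace_scale)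
    then have "(v \<bullet> f v) / (norm v)\<^sup>2 \<le> c"
      by (simp add: linear_scale[OF lin] power2_eq_square)
    then show ?thesis
      using False by (simp add: divide_le_eq power2_norm_eq_inner)
  qed simp
  define h where "h = f u - c *\<^sub>R u"
  define K where "K = h \<bullet> f h - c * (h \<bullet> h)"
  have hS: "h \<in> S"
    unfolding h_def using u inv S by (auto intro!: subspace_diff subspace_scale)
  have uu: "u \<bullet> u = 1"
    using u by (simp add: norm_eq_1)
  have hh: "h \<bullet> f u - c * (u \<bullet> h) = h \<bullet> h"
    by (subst (4) h_def) (simp add: inner_diff_right inner_commute)
  \<comment> \<open>First-order optimality of \<open>u\<close> in the direction \<open>h\<close>.\<close>
  have quad: "2 * s * (h \<bullet> h) + s\<^sup>2 * K \<le> 0" for s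
  proof -
    have "u + s *\<^sub>R h \<in> S"
      using u hS S by (simp add: subspace_add subspace_scale)
    from le[OF this] have "2 * s * (h \<bullet> f u - c * (u \<bullet> h)) + s\<^sup>2 * K \<le> 0"
      using adj[of u h] uu
      by (simp add: linear_add[OF lin] linear_scale[OF lin] inner_add_left inner_add_right K_def
          c_def[symmetric] inner_commute algebra_simps power2_eq_square)
    then show ?thesis by (simp add: hh)
  qed
  have "h \<bullet> h = 0"
  proof (rule ccontr)
    assume "h \<bullet> h \<noteq> 0"
    then have pos: "h \<bullet> h > 0" by simp
    \<comment> \<open>This step is so short that the quadratic term \<open>s * K\<close> cannot
      outweigh the linear one: \<open>s * \<bar>K\<bar> < h \<bullet> h\<close>.\<close>
    define s where "s = (h \<bullet> h) / (\<bar>K\<bar> + 1)"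
    have s: "s > 0" and "s * (\<bar>K\<bar> + 1) = h \<bullet> h" using pos by (auto simp: s_def)
    have "s * (2 * (h \<bullet> h) + s * K) \<le> 0"
      using quad[of s] by (simp add: algebra_simps power2_eq_square)
    then have "2 * (h \<bullet> h) + s * K \<le> 0"
      using s by (simp add: mult_le_0_iff)
    moreover have "s * - K \<le> s * (\<bar>K\<bar> + 1)"
      using s by (intro mult_left_mono) auto
    ultimately show False using \<open>s * (\<bar>K\<bar> + 1) = h \<bullet> h\<close> pos by simp
  qed
  then show thesis
    using that[of u c] u by (simp add: h_def)
qed

text \<open>Induction on \<open>k\<close>: the orthogonal complement of the eigenvectors found so
  far is nonzero by dimension and invariant because \<open>f\<close> is self-adjoint, so it contains
  a further unit eigenvector.\<close>

lemma self_adjoint_orthonormal_eigenvectors: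
  fixes f :: "'a::euclidean_space \<Rightarrow> 'a"
  assumes lin: "linear f" and adj: "\<And>x y. f x \<bullet> y = x \<bullet> f y"
    and "k \<le> DIM('a)"
  shows "\<exists>B. finite B \<and> card B = k \<and> pairwise orthogonal B \<and> (\<forall>b\<in>B. norm b = 1 \<and> (\<exists>c. f b = c *\<^sub>R b))"
  using assms(3)
proof (induction k)
  case 0
  show ?case by (intro exI[of _ "{}"]) simp
next
  case (Suc k)
  then obtain B where B: "finite B" "card B = k" "pairwise orthogonal B"
    and eig: "\<And>b. b \<in> B \<Longrightarrow> norm b = 1 \<and> (\<exists>c. f b = c *\<^sub>R b)" by auto
  define S where "S = {v. \<forall>b\<in>B. b \<bullet> v = 0}"
  have "card B < DIM('a)"
    using B Suc by simp
  then obtain w where "w \<noteq> 0" "\<And>b. b \<in> B \<Longrightarrow> b \<bullet> w = 0"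
    using orthogonal_to_few_exists[OF B(1)] by metis
  then have ne: "S \<noteq> {0}" by (auto simp: S_def)
  have sub: "subspace S"
    by (auto simp: S_def subspace_def inner_add_right)
  have inv: "f ` S \<subseteq> S"
  proof clarify
    fix v assume v: "v \<in> S"
    have "b \<bullet> f v = 0" if "b \<in> B" for b
      using eig[OF that] adj[of b v] v that by (auto simp: S_def)
    then show "f v \<in> S" by (simp add: S_def)
  qed
  obtain u c where u: "u \<in> S" "norm u = 1" "f u = c *\<^sub>R u"
    using self_adjoint_eigenvector_exists[OF lin adj sub ne inv] by metis
  \<comment> \<open>A member of \<open>B\<close> lying in \<open>S\<close> would be orthogonal to
    itself, against \<open>norm u = 1\<close>.\<close>
  have "u \<notin> B"
    using u by (force simp: S_def)
  moreover have "pairwise orthogonal (insert u B)"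
    using B(3) u(1) by (auto simp: pairwise_insert S_def orthogonal_def inner_commute)
  ultimately show ?case
    using B u eig by (intro exI[of _ "insert u B"]) auto
qed

section \<open>Orthogonal diagonalisation of symmetric matrices\<close>

definition diag_matrix :: "('p \<Rightarrow> real) \<Rightarrow> real ^ 'p ^ 'p" where
  "diag_matrix d = (\<chi> i j. if i = j then d i else 0)"

text \<open>The entries of \<open>d\<close> are indexed by \<open>'p\<close> and carry no order;
  multiplicities are kept, so spectral statements become cardinalities of index sets.\<close>

definition diagonalizes :: "real ^ 'p ^ 'p \<Rightarrow> ('p \<Rightarrow> real) \<Rightarrow> real ^ 'p ^ 'p \<Rightarrow> bool" where
  "diagonalizes Q d A \<longleftrightarrow> orthogonal_matrix Q \<and> A = Q ** diag_matrix d ** transpose Q"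

lemma diag_matrix_mult_component: "(diag_matrix d ** A) $ i $ j = d i * A $ i $ j"
proof -
  have "(if i = k then d i else 0) * A $ k $ j = (if i = k then d i * A $ k $ j else 0)" for k
    by simp
  then show ?thesis
    by (simp add: diag_matrix_def matrix_matrix_mult_def)
qed

lemma diag_matrix_mult: "diag_matrix d ** diag_matrix e = diag_matrix (\<lambda>i. d i * e i)"
proof -
  have "(diag_matrix d ** diag_matrix e) $ i $ j = diag_matrix (\<lambda>i. d i * e i) $ i $ j" for i j
    by (simp add: diag_matrix_mult_component) (simp add: diag_matrix_def)
  then show ?thesis
    by (simp add: vec_eq_iff)
qed

lemma transpose_diag_matrix: "transpose (diag_matrix d) = diag_matrix d"
  by (simp add: diag_matrix_def transpose_def vec_eq_iff)

lemma diag_matrix_vec: "(diag_matrix d *v v) $ i = d i * v $ i"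
  by (simp add: diag_matrix_def matrix_vector_mult_def if_distrib if_distribR sum.delta cong: if_cong)

text \<open>An orthonormal basis of eigenvectors, enumerated by \<open>'p\<close>, supplies the
  columns of \<open>Q\<close>.\<close>

lemma symmetric_diagonalizable:
  fixes A :: "real ^ 'p ^ 'p"
  assumes "transpose A = A"
  obtains Q d where "diagonalizes Q d A"
proof -
  have adj: "(A *v x) \<bullet> y = x \<bullet> (A *v y)" for x y
    using assms by (metis dot_lmul_matrix transpose_matrix_vector)
  obtain B where B: "finite B" "card B = CARD('p)" "pairwise orthogonal B"
    and eig: "\<And>b. b \<in> B \<Longrightarrow> norm b = 1 \<and> (\<exists>c. A *v b = c *\<^sub>R b)"
    using self_adjoint_orthonormal_eigenvectors[OF matrix_vector_mul_linear[of A] adj, of "CARD('p)"]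
    by auto
  obtain q where q: "bij_betw q (UNIV :: 'p set) B"
    using B finite_same_card_bij[of "UNIV :: 'p set" B] by auto
  have qB: "q i \<in> B" for i
    using q by (auto simp: bij_betw_def)
  obtain d where d: "\<And>i. A *v q i = d i *\<^sub>R q i"
    using eig[OF qB] by metis
  define Q where "Q = (\<chi> i j. q j $ i)"
  have col: "column j Q = q j" for j
    by (simp add: Q_def column_def vec_eq_iff)
  have orth: "orthogonal_matrix Q"
    unfolding orthogonal_matrix_orthonormal_columns col
    using eig[OF qB] B(3) qB bij_betw_imp_inj_on[OF q] by (metis UNIV_I inj_onD pairwiseD)
  have "A ** Q = Q ** diag_matrix d"
  proof -
    have "(A ** Q) $ i $ j = (A *v q j) $ i" for i j
      by (simp add: matrix_matrix_mult_def matrix_vector_mult_def Q_def)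
    moreover have "(Q ** diag_matrix d) $ i $ j = (d j *\<^sub>R q j) $ i" for i j
      by (simp add: matrix_matrix_mult_def Q_def diag_matrix_def if_distrib if_distribR sum.delta
          cong: if_cong)
    ultimately show ?thesis by (simp add: vec_eq_iff d)
  qed
  then have "A = Q ** diag_matrix d ** transpose Q"
    using orth by (metis matrix_mul_assoc matrix_mul_rid orthogonal_matrix_def)
  with orth that show thesis
    by (auto simp: diagonalizes_def)
qed

section \<open>Quadratic forms in eigenvector coordinates\<close>

lemma vector_matrix_mult_component: "(v v* Q) $ i = column i Q \<bullet> (v :: real ^ 'm)"
  by (simp add: vector_matrix_mult_def column_def inner_vec_def mult.commute)

lemma diagonalizes_inner:
  assumes "diagonalizes Q d A"
  shows "v \<bullet> (A *v v) = (\<Sum>i\<in>UNIV. d i * (column i Q \<bullet> v)\<^sup>2)"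
proof -
  have "v \<bullet> (A *v v) = (v v* Q) \<bullet> (diag_matrix d *v (v v* Q))"
    using assms by (simp add: diagonalizes_def matrix_vector_mul_assoc[symmetric] dot_lmul_matrix)
  also have "\<dots> = (\<Sum>i\<in>UNIV. d i * (column i Q \<bullet> v)\<^sup>2)"
    by (simp add: inner_vec_def[of "v v* Q"] diag_matrix_vec vector_matrix_mult_component
        power2_eq_square mult_ac)
  finally show ?thesis .
qed

text \<open>Parseval's identity, read off from the diagonalisation of the identity matrix by
  \<open>Q\<close>.\<close>

lemma orthogonal_matrix_inner_self:
  fixes Q :: "real ^ 'p ^ 'p"
  assumes "orthogonal_matrix Q"
  shows "v \<bullet> v = (\<Sum>i\<in>UNIV. (column i Q \<bullet> v)\<^sup>2)"
proof -
  have "diag_matrix (\<lambda>_. 1) = mat 1"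
    by (simp add: diag_matrix_def mat_def)
  then have "diagonalizes Q (\<lambda>_. 1) (mat 1)"
    using assms unfolding diagonalizes_def orthogonal_matrix_def by (metis matrix_mul_rid)
  from diagonalizes_inner[OF this, of v] show ?thesis by simp
qed

text \<open>Lets a bound on the number of eigenvalues above a level also serve for eigenvalues below
  a level.\<close>

lemma diagonalizes_uminus:
  assumes "diagonalizes Q d A"
  shows "diagonalizes Q (\<lambda>i. - d i) (- A)"
proof -
  have "diag_matrix (\<lambda>i. - d i) = - diag_matrix d"
    by (simp add: diag_matrix_def vec_eq_iff)
  moreover have "Q ** (- D) ** R = - (Q ** D ** R)" for D R :: "real ^ 'a ^ 'a"
    by (simp add: matrix_matrix_mult_def vec_eq_iff sum_negf)
  ultimately show ?thesis
    using assms by (simp add: diagonalizes_def)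
qed

text \<open>The quadratic form takes the value \<open>d k\<close> at the unit eigenvector
  \<open>column k Q\<close>.\<close>

lemma diagonalizes_nonneg:
  assumes "diagonalizes Q d A" "psd A"
  shows "d k \<ge> 0"
proof -
  have "orthogonal_matrix Q"
    using assms by (simp add: diagonalizes_def)
  then have "column i Q \<bullet> column k Q = (if i = k then 1 else 0)" for i
    by (auto simp: orthogonal_matrix_orthonormal_columns orthogonal_def norm_eq_1)
  then have "column k Q \<bullet> (A *v column k Q) = (\<Sum>i\<in>UNIV. if i = k then d i else 0)"
    unfolding diagonalizes_inner[OF assms(1)] by (intro sum.cong) auto
  also have "\<dots> = d k"
    by simp
  finally show ?thesis
    using assms(2) by (metis psd_def)
qed

section \<open>Moore-Penrose inverse and spectral distribution from a diagonalisation\<close>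

text \<open>Since \<open>inverse 0 = 0\<close>, the scalar \<open>inverse\<close> is already the
  pseudo-inverse of a real number. In the basis \<open>Q\<close> the four Penrose equations reduce
  to scalar identities, and uniqueness identifies the result.\<close>

lemma diagonalizes_mp_inverse:
  assumes "diagonalizes Q d A"
  shows "diagonalizes Q (\<lambda>i. inverse (d i)) (mp_inverse A)"
proof -
  define B where "B = Q ** diag_matrix (\<lambda>i. inverse (d i)) ** transpose Q"
  have Q: "orthogonal_matrix Q" and A: "A = Q ** diag_matrix d ** transpose Q"
    using assms by (auto simp: diagonalizes_def)
  have mul: "(Q ** diag_matrix a ** transpose Q) ** (Q ** diag_matrix b ** transpose Q)
      = Q ** diag_matrix (\<lambda>i. a i * b i) ** transpose Q" for a b
  proof -
    have "(Q ** diag_matrix a ** transpose Q) ** (Q ** diag_matrix b ** transpose Q)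
        = Q ** diag_matrix a ** (transpose Q ** Q) ** diag_matrix b ** transpose Q"
      by (simp only: matrix_mul_assoc)
    also have "\<dots> = Q ** (diag_matrix a ** diag_matrix b) ** transpose Q"
      using Q by (simp add: orthogonal_matrix_def matrix_mul_assoc)
    finally show ?thesis by (simp add: diag_matrix_mult)
  qed
  have tr: "transpose (Q ** diag_matrix a ** transpose Q) = Q ** diag_matrix a ** transpose Q" for a
    by (simp add: matrix_transpose_mul transpose_diag_matrix matrix_mul_assoc)
  have inv: "x * inverse x * x = x" "inverse x * x * inverse x = inverse x" for x :: real
    by (cases "x = 0"; simp)+
  have "(\<lambda>i. d i * inverse (d i) * d i) = d"
    "(\<lambda>i. inverse (d i) * d i * inverse (d i)) = (\<lambda>i. inverse (d i))"
    by (simp_all only: inv)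
  then have "is_mp_inverse A B"
    unfolding is_mp_inverse_def A B_def mul tr by simp
  then have "mp_inverse A = B"
    unfolding mp_inverse_def using is_mp_inverse_unique by blast
  then show ?thesis
    using Q by (simp add: diagonalizes_def B_def)
qed

text \<open>Determinants are invariant under orthogonal similarity, so both polynomials agree at
  every real point, which determines them.\<close>

lemma diagonalizes_charpoly:
  assumes "diagonalizes Q d A"
  shows "charpoly A = (\<Prod>i\<in>UNIV. [:- d i, 1:])"
proof -
  have Q: "orthogonal_matrix Q" and A: "A = Q ** diag_matrix d ** transpose Q"
    using assms by (auto simp: diagonalizes_def)
  have "poly (charpoly A) x = poly (\<Prod>i\<in>UNIV. [:- d i, 1:]) x" for x
  proof -
    have diag: "mat x = diag_matrix (\<lambda>_. x)"
      by (simp add: diag_matrix_def mat_def)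
    \<comment> \<open>Scalar matrices are fixed by the conjugation, so \<open>mat x\<close> can be
      moved inside it together with \<open>diag_matrix d\<close>.\<close>
    have "Q ** mat x ** transpose Q = mat x"
    proof -
      have "Q ** mat x = x *\<^sub>R Q"
        by (simp add: matrix_matrix_mult_def mat_def vec_eq_iff if_distrib if_distribR sum.delta
          mult.commute cong: if_cong)
      then have "Q ** mat x ** transpose Q = x *\<^sub>R (Q ** transpose Q)"
        by (simp add: scalar_matrix_assoc)
      then show ?thesis
        using Q by (simp add: orthogonal_matrix_def mat_def vec_eq_iff)
    qed
    moreover have "Q ** (B - C) ** R = Q ** B ** R - Q ** C ** R" for B C R :: "real ^ 'a ^ 'a"
      by (simp add: matrix_matrix_mult_def vec_eq_iff right_diff_distrib left_diff_distrib sum_subtractf)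
    ultimately have "mat x - A = Q ** (mat x - diag_matrix d) ** transpose Q"
      by (simp add: A)
    then have "det (mat x - A) = det (Q ** transpose Q) * det (mat x - diag_matrix d)"
      by (simp add: det_mul)
    also have "\<dots> = det (mat x - diag_matrix d)"
      using Q by (simp add: orthogonal_matrix_def)
    also have "\<dots> = (\<Prod>i\<in>UNIV. x - d i)"
      by (subst det_diagonal) (auto simp: diag diag_matrix_def)
    finally show ?thesis
      by (simp add: poly_charpoly poly_prod)
  qed
  then show ?thesis
    by (simp add: poly_eq_poly_eq_iff[symmetric] fun_eq_iff)
qed

lemma proots_prod_linear:
  fixes d :: "'b \<Rightarrow> 'a::idom"
  assumes "finite I"
  shows "proots (\<Prod>i\<in>I. [:- d i, 1:]) = image_mset d (mset_set I)"
  using assms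
proof (induction I rule: finite_induct)
  case (insert i I)
  have "(\<Prod>i\<in>I. [:- d i, 1:]) \<noteq> 0"
    using insert by simp
  then show ?case
    using insert by (simp add: proots_mult del: mult_pCons_left)
qed simp

text \<open>The sorted list \<open>eigvals A\<close> enters only through a sum, hence through its
  multiset, which is that of the values of \<open>d\<close>.\<close>

lemma diagonalizes_esd:
  fixes A :: "real ^ 'p ^ 'p"
  assumes "diagonalizes Q d A"
  shows "esd A t = real (card {i. d i \<le> t}) / real CARD('p)"
proof -
  have mset: "mset (eigvals A) = image_mset d (mset_set UNIV)"
    using diagonalizes_charpoly[OF assms] by (simp add: eigvals_def proots_prod_linear)
  then have len: "length (eigvals A) = CARD('p)"
    by (metis size_image_mset size_mset size_mset_set)
  have "(\<Sum>i<CARD('p). indicator {..t} (eigvals A ! i))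
      = (\<Sum>x\<leftarrow>eigvals A. indicator {..t} x :: real)"
    by (simp add: sum_list_sum_nth len atLeast0LessThan)
  also have "\<dots> = (\<Sum>x\<in>#mset (eigvals A). indicator {..t} x)"
    by (metis mset_map sum_mset_sum_list)
  also have "\<dots> = (\<Sum>i\<in>UNIV. indicator {..t} (d i))"
    by (simp add: mset sum_unfold_sum_mset image_mset.compositionality comp_def)
  also have "\<dots> = real (card {i. d i \<le> t})"
    by (simp add: indicator_def sum.If_cases)
  finally show ?thesis
    by (simp add: esd_def)
qed

section \<open>Rank-one perturbations and eigenvalue counts\<close>

text \<open>Too few constraints would leave a nonzero \<open>v\<close> orthogonal to \<open>w\<close>, to the eigenvectors of \<open>A\<close>
  below the level and to those of \<open>B\<close> above it; on it the two quadratic forms cannot agree.\<close>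

lemma rank_one_eigenvalue_count:
  fixes A B :: "real ^ 'p ^ 'p"
  assumes A: "diagonalizes Q d A" and B: "diagonalizes R e B"
    and eq: "\<And>v. w \<bullet> v = 0 \<Longrightarrow> v \<bullet> (A *v v) = v \<bullet> (B *v v)"
  shows "card {i. c \<le> d i} \<le> card {i. c \<le> e i} + 1"
proof (rule ccontr)
  assume less: "\<not> ?thesis"
  define W where "W = insert w ((\<lambda>i. column i Q) ` {i. d i < c} \<union> (\<lambda>i. column i R) ` {i. c \<le> e i})"
  have "card {i. d i < c} + card {i. c \<le> d i} = card ({i. d i < c} \<union> {i. c \<le> d i})"
    by (subst card_Un_disjoint) auto
  also have "{i. d i < c} \<union> {i. c \<le> d i} = UNIV"
    by auto
  finally have split: "card {i. d i < c} + card {i. c \<le> d i} = CARD('p)" .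
  have "card W \<le> Suc (card ((\<lambda>i. column i Q) ` {i. d i < c} \<union> (\<lambda>i. column i R) ` {i. c \<le> e i}))"
    unfolding W_def by (simp add: card_insert_if)
  also have "\<dots> \<le> Suc (card ((\<lambda>i. column i Q) ` {i. d i < c}) + card ((\<lambda>i. column i R) ` {i. c \<le> e i}))"
    by (simp add: card_Un_le)
  also have "\<dots> \<le> Suc (card {i. d i < c} + card {i. c \<le> e i})"
    by (intro Suc_le_mono[THEN iffD2] add_mono card_image_le) auto
  \<comment> \<open>The negated claim gives at least two more indices with
    \<open>c \<le> d i\<close> than with \<open>c \<le> e i\<close>. With \<open>split\<close>, this
    leaves \<open>W\<close> at most \<open>CARD('p) - 1\<close> elements, the extra vector
    \<open>w\<close> included.\<close>
  finally have "card W < DIM(real ^ 'p)"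
    using less split by simp
  moreover have "finite W"
    by (simp add: W_def)
  ultimately obtain v where v: "v \<noteq> 0" and W: "\<And>b. b \<in> W \<Longrightarrow> b \<bullet> v = 0"
    using orthogonal_to_few_exists[of W] by metis
  have vQ: "column i Q \<bullet> v = 0" if "d i < c" for i
    using W that by (auto simp: W_def)
  have vR: "column i R \<bullet> v = 0" if "c \<le> e i" for i
    using W that by (auto simp: W_def)
  have nQ: "v \<bullet> v = (\<Sum>i\<in>UNIV. (column i Q \<bullet> v)\<^sup>2)" and nR: "v \<bullet> v = (\<Sum>i\<in>UNIV. (column i R \<bullet> v)\<^sup>2)"
    using A B orthogonal_matrix_inner_self by (auto simp: diagonalizes_def)
  have "c * (v \<bullet> v) \<le> v \<bullet> (A *v v)"
    unfolding nQ diagonalizes_inner[OF A] sum_distrib_left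
  proof (rule sum_mono)
    show "c * (column i Q \<bullet> v)\<^sup>2 \<le> d i * (column i Q \<bullet> v)\<^sup>2" for i
      using vQ[of i] by (cases "d i < c") (auto intro: mult_right_mono)
  qed
  moreover have "v \<bullet> (B *v v) < c * (v \<bullet> v)"
  proof -
    \<comment> \<open>A nonzero coordinate of \<open>v\<close> belongs by \<open>vR\<close> to an
      eigenvalue \<open>e i < c\<close>; this makes the upper bound strict, as the contradiction
      requires.\<close>
    have "\<exists>i. column i R \<bullet> v \<noteq> 0"
    proof (rule ccontr)
      assume "\<not> ?thesis"
      then have "v \<bullet> v = 0"
        unfolding nR by simp
      then show False
        using v by simp
    qed
    then obtain i where i: "column i R \<bullet> v \<noteq> 0" ..
    show ?thesis
      unfolding nR diagonalizes_inner[OF B] sum_distrib_left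
    proof (rule sum_strict_mono_ex1)
      have "e i * (column i R \<bullet> v)\<^sup>2 \<le> c * (column i R \<bullet> v)\<^sup>2" for i
        using vR[of i] by (cases "c \<le> e i") (auto intro: mult_right_mono)
      then show "\<forall>i\<in>UNIV. e i * (column i R \<bullet> v)\<^sup>2 \<le> c * (column i R \<bullet> v)\<^sup>2" by blast
      show "\<exists>i\<in>UNIV. e i * (column i R \<bullet> v)\<^sup>2 < c * (column i R \<bullet> v)\<^sup>2"
        using i vR by (intro bexI[of _ i]) (auto intro!: mult_strict_right_mono simp: not_le[symmetric])
    qed simp
  qed
  moreover have "v \<bullet> (A *v v) = v \<bullet> (B *v v)"
    using eq W by (simp add: W_def)
  ultimately show False by simp
qed

text \<open>The zero eigenvalues and the large eigenvalues each contribute one unit to the 2. The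
  hypotheses are symmetric in \<open>A\<close> and \<open>B\<close>, so exchanging them gives the
  reverse inequality.\<close>

lemma rank_one_esd_mp_inverse:
  fixes A B :: "real ^ 'p ^ 'p"
  assumes A: "psd A" and B: "psd B"
    and eq: "\<And>v. w \<bullet> v = 0 \<Longrightarrow> v \<bullet> (A *v v) = v \<bullet> (B *v v)"
  shows "esd (mp_inverse A) t \<le> esd (mp_inverse B) t + 2 / real CARD('p)"
proof -
  obtain Q d where Q: "diagonalizes Q d A"
    using A symmetric_diagonalizable unfolding psd_def by metis
  obtain R e where R: "diagonalizes R e B"
    using B symmetric_diagonalizable unfolding psd_def by metis
  have d: "d i \<ge> 0" and e: "e i \<ge> 0" for i
    using diagonalizes_nonneg Q R A B by auto
  have "card {i. inverse (d i) \<le> t} \<le> card {i. inverse (e i) \<le> t} + 2"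
  proof (cases "t < 0")
    case True
    then have "{i. inverse (d i) \<le> t} = {}"
      using d by (auto simp: not_le intro: less_le_trans)
    then show ?thesis by simp
  next
    case False
    have iff: "inverse x \<le> t \<longleftrightarrow> x = 0 \<or> x > 0 \<and> 1 \<le> t * x" if "x \<ge> 0" for x
      using that False by (auto simp: inverse_eq_divide divide_le_eq)
    \<comment> \<open>For nonnegative \<open>f\<close>, the condition \<open>0 \<le> - f i\<close>
      means \<open>f i = 0\<close>; in this form it counts eigenvalues of the negated matrix above
      level 0. The case \<open>t = 0\<close> is separate because \<open>1 / 0 = 0\<close> would make
      the second set everything instead of empty.\<close>
    have count: "card {i. inverse (f i) \<le> t} = card {i. 0 \<le> - f i} + (if t = 0 then 0 else card {i. 1 / t \<le> f i})"
      if "\<And>i. f i \<ge> 0" for f :: "'p \<Rightarrow> real"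
    proof -
      have "{i. inverse (f i) \<le> t} = {i. 0 \<le> - f i} \<union> {i. 1 \<le> t * f i}"
        using iff that by (force simp: order.order_iff_strict)
      moreover have "{i. 1 \<le> t * f i} = (if t = 0 then {} else {i. 1 / t \<le> f i})"
        using False by (auto simp: divide_le_eq mult.commute)
      moreover have "{i. 0 \<le> - f i} \<inter> {i. 1 \<le> t * f i} = {}"
        using that by (smt (verit) disjoint_iff mem_Collect_eq mult_eq_0_iff)
      ultimately show ?thesis
        by (simp add: card_Un_disjoint)
    qed
    have minus_mult: "(- C) *v v = - (C *v v)" for C :: "real ^ 'p ^ 'p" and v
      by (simp add: matrix_vector_mult_def vec_eq_iff sum_negf)
    have "card {i. 1 / t \<le> d i} \<le> card {i. 1 / t \<le> e i} + 1"
      by (rule rank_one_eigenvalue_count[OF Q R eq])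
    moreover have "card {i. 0 \<le> - d i} \<le> card {i. 0 \<le> - e i} + 1"
      using eq by (intro rank_one_eigenvalue_count[OF diagonalizes_uminus[OF Q] diagonalizes_uminus[OF R], of w])
        (simp add: minus_mult)
    ultimately show ?thesis
      using count d e by simp
  qed
  then have "real (card {i. inverse (d i) \<le> t}) \<le> real (card {i. inverse (e i) \<le> t}) + 2"
    by linarith
  then show ?thesis
    unfolding diagonalizes_esd[OF diagonalizes_mp_inverse[OF Q]]
      diagonalizes_esd[OF diagonalizes_mp_inverse[OF R]] add_divide_distrib[symmetric]
    by (intro divide_right_mono) auto
qed

section \<open>Quadratic forms of the two sample covariance matrices\<close>

lemma inner_sample_cov:
  fixes Y :: "real ^ 'n ^ 'p"
  shows "v \<bullet> (sample_cov Y *v v) = (\<Sum>j\<in>UNIV. (column j Y \<bullet> v)\<^sup>2) / real CARD('n)"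
proof -
  have "v \<bullet> (sample_cov Y *v v) = (1 / real CARD('n)) * (v \<bullet> (Y *v (v v* Y)))"
    by (simp add: sample_cov_def scaleR_matrix_vector_assoc[symmetric]
        matrix_vector_mul_assoc[symmetric])
  also have "v \<bullet> (Y *v (v v* Y)) = (v v* Y) \<bullet> (v v* Y)"
    by (simp add: dot_lmul_matrix)
  finally show ?thesis
    by (simp add: inner_vec_def[of "v v* Y"] vector_matrix_mult_component power2_eq_square)
qed

text \<open>The rank-one correction is visible here: it vanishes on the hyperplane orthogonal to the
  sample mean.\<close>

lemma inner_centered_sample_cov:
  "v \<bullet> (centered_sample_cov Y *v v) = v \<bullet> (sample_cov Y *v v) - (sample_mean Y \<bullet> v)\<^sup>2"
proof -
  have "(\<chi> i j. m $ i * m $ j) *v v = (m \<bullet> v) *\<^sub>R m" for m :: "real ^ 'a"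
    by (simp add: matrix_vector_mult_def vec_eq_iff inner_vec_def sum_distrib_left mult_ac)
  then show ?thesis
    by (simp add: centered_sample_cov_def matrix_vector_mult_diff_rdistrib inner_diff_right
        power2_eq_square inner_commute)
qed

lemma psd_sample_cov: "psd (sample_cov Y)"
proof -
  have "transpose (sample_cov Y) = sample_cov Y"
    by (simp add: sample_cov_def transpose_scalar matrix_transpose_mul)
  then show ?thesis
    by (simp add: psd_def inner_sample_cov sum_nonneg)
qed

text \<open>Cauchy-Schwarz: the squared mean of the numbers \<open>column j Y \<bullet> v\<close> is
  at most the mean of their squares.\<close>

lemma psd_centered_sample_cov:
  fixes Y :: "real ^ 'n ^ 'p"
  shows "psd (centered_sample_cov Y)"
proof -
  let ?n = "real CARD('n)"
  have "sample_cov Y $ j $ i = sample_cov Y $ i $ j" for i j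
    using psd_sample_cov[of Y] by (auto simp: psd_def transpose_def vec_eq_iff)
  then have "transpose (centered_sample_cov Y) = centered_sample_cov Y"
    by (simp add: centered_sample_cov_def transpose_def vec_eq_iff mult.commute)
  moreover have "0 \<le> v \<bullet> (centered_sample_cov Y *v v)" for v
  proof -
    have "(sample_mean Y \<bullet> v)\<^sup>2 = (\<Sum>j\<in>UNIV. column j Y \<bullet> v)\<^sup>2 / ?n\<^sup>2"
      by (simp add: sample_mean_def inner_sum_left power_divide)
    also have "\<dots> \<le> (?n * (\<Sum>j\<in>UNIV. (column j Y \<bullet> v)\<^sup>2)) / ?n\<^sup>2"
      using sum_squared_le_sum_of_squares[of "\<lambda>j. column j Y \<bullet> v" UNIV]
      by (intro divide_right_mono) (auto simp: mult.commute)
    also have "\<dots> = v \<bullet> (sample_cov Y *v v)"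
      by (simp add: inner_sample_cov power2_eq_square)
    finally show ?thesis
      by (simp add: inner_centered_sample_cov)
  qed
  ultimately show ?thesis
    by (simp add: psd_def)
qed

theorem lemma2p1:
  fixes M :: "'a measure"
    and X :: "'a \<Rightarrow> real ^ 'n ^ 'p"
    and \<Sigma> :: "real ^ 'p ^ 'p"
    and Y :: "'a \<Rightarrow> real ^ 'n ^ 'p"
  assumes "prob_space M"
    and "iid_standardized_entries M X"
    and "psd \<Sigma>"
    and "CARD('p) > CARD('n)"
    and Y_def: "\<And>\<omega>. Y \<omega> = psd_sqrt \<Sigma> ** X \<omega>"
  shows "\<forall>\<omega>\<in>space M.
    sup_norm (\<lambda>t. esd (mp_inverse (centered_sample_cov (Y \<omega>))) t - esd (mp_inverse (sample_cov (Y \<omega>))) t)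
      \<le> 2 / real CARD('p)"
proof
  fix \<omega>
  let ?A = "centered_sample_cov (Y \<omega>)" and ?B = "sample_cov (Y \<omega>)"
  have eq: "\<And>v. sample_mean (Y \<omega>) \<bullet> v = 0 \<Longrightarrow> v \<bullet> (?A *v v) = v \<bullet> (?B *v v)"
    by (simp add: inner_centered_sample_cov)
  have "\<bar>esd (mp_inverse ?A) t - esd (mp_inverse ?B) t\<bar> \<le> 2 / real CARD('p)" for t
    \<comment> \<open>Both orders of the two matrices are used, one for each sign inside the
      absolute value; \<open>w\<close> is the sample mean in both.\<close>
    using rank_one_esd_mp_inverse[OF psd_centered_sample_cov psd_sample_cov eq, where w = "sample_mean (Y \<omega>)" and t = t]
      rank_one_esd_mp_inverse[OF psd_sample_cov psd_centered_sample_cov eq[symmetric], where w = "sample_mean (Y \<omega>)" and t = t]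
    by (simp add: abs_le_iff)
  then show "sup_norm (\<lambda>t. esd (mp_inverse ?A) t - esd (mp_inverse ?B) t) \<le> 2 / real CARD('p)"
    unfolding sup_norm_def by (intro SUP_least) simp
qed

end
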